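(* Let $\mathcal{C},\mathcal{D},\mathcal{E}$ be concrete categories over a category $\mathcal{B}$. (Left version) Let $F:\mathcal{C}\to\mathcal{D}$ be a finally dense concrete functor over $\mathcal{B}$, and let $(L,R)$, $(L',R')$ be Galois correspondences with $L,L':\mathcal{D}\to\mathcal{E}$ and $R,R':\mathcal{E}\to\mathcal{D}$. If $LF\cong L'F$, then $L\cong L'$. In particular, if $\mathcal{D}$ has a co-Sierpiński object $X$ and $LX\cong L'X$, then $L\cong L'$. (Right version) Let $F:\mathcal{C}\to\mathcal{D}$ be an initially dense concrete functor over $\mathcal{B}$, and let $(L,R)$, $(L',R')$ be Galois correspondences with $L,L':\mathcal{E}\to\mathcal{D}$ and $R,R':\mathcal{D}\to\mathcal{E}$. If $RF\cong R'F$, then $R\cong R'$. In particular, if $\mathcal{D}$ has a Sierpiński object $X$ and $RX\cong R'X$, then $R\cong R'$.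
   Context: Concrete categories. A concrete category $\mathcal{E}$ over $\mathcal{B}$ (a faithful functor $|\text{-}|:\mathcal{E}\to\mathcal{B}$, with $\mathcal{E}(X,Y)$ identified with its image) is given by a class $\mathcal{E}_0$ of objects, a function $|\text{-}|:\mathcal{E}_0\to\mathcal{B}_0$, and subsets $\mathcal{E}(X,Y)\subseteq\mathcal{B}(|X|,|Y|)$ with $1_{|X|}\in\mathcal{E}(X,X)$ and $\mathcal{E}(Y,Z)\circ\mathcal{E}(X,Y)\subseteq\mathcal{E}(X,Z)$. A map $f\in\mathcal{B}(|X|,|Y|)$ is an $\mathcal{E}$-morphism if $f\in\mathcal{E}(X,Y)$. A concrete functor $F:\mathcal{D}\to\mathcal{E}$ is a function $F:\mathcal{D}_0\to\mathcal{E}_0$ with $|FX|=|X|$ and $\mathcal{D}(X,Y)\subseteq\mathcal{E}(FX,FY)$. Order and $\cong$. In a concrete category $\mathcal{E}$, $X\le Y$ means $|X|=|Y|$ and $1_{|X|}\in\mathcal{E}(X,Y)$; $X\cong Y$ means $X\le Y$ and $Y\le X$ (stronger than isomorphism in the ordinary sense). Concrete functors are ordered pointwise, and $F\cong G$ means $FX\cong GX$ for all $X$. Galois correspondences. Concrete functors $L:\mathcal{D}\to\mathcal{E}$ and $R:\mathcal{E}\to\mathcal{D}$ form a Galois correspondence $(L,R)$ if $1_{\mathcal{D}}\le RL$ and $LR\le 1_{\mathcal{E}}$; equivalently $\mathcal{E}(LX,Y)=\mathcal{D}(X,RY)$ for all $X\in\mathcal{D}_0$, $Y\in\mathcal{E}_0$.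 Density. A (possibly large) family of $\mathcal{E}$-morphisms $(g_i:Y\to X_i)_{i\in I}$ is an initial source if for any $Z\in\mathcal{E}_0$, a map $f:|Z|\to|Y|$ is an $\mathcal{E}$-morphism as soon as all $g_i\circ f$ are $\mathcal{E}$-morphisms $Z\to X_i$. A family of $\mathcal{E}$-morphisms $(f_i:X_i\to Y)_{i\in I}$ is a final sink if for any $Z\in\mathcal{E}_0$, a map $g:|Y|\to|Z|$ is an $\mathcal{E}$-morphism as soon as all $g\circ f_i$ are $\mathcal{E}$-morphisms $X_i\to Z$. A concrete functor $F:\mathcal{D}\to\mathcal{E}$ is initially dense (resp. finally dense) if every $Y\in\mathcal{E}_0$ is the domain (resp. codomain) of some initial source $(g_i:Y\to FX_i)_{i\in I}$ (resp. final sink $(f_i:FX_i\to Y)_{i\in I}$) in $\mathcal{E}$ with $X_i\in\mathcal{D}_0$ for all $i\in I$. An object $X$ is Sierpiński (resp. co-Sierpiński) if the inclusion of the one-object full subcategory $\{X\}$ is initially dense (resp. finally dense). *)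

theory Defs
  imports Main
begin

record ('o, 'm) precat =
  Obj :: "'o set"
  Arr :: "'m set"
  Dom :: "'m \<Rightarrow> 'o"
  Cod :: "'m \<Rightarrow> 'o"
  Id :: "'o \<Rightarrow> 'm"
  Comp :: "'m \<Rightarrow> 'm \<Rightarrow> 'm"  (* Comp B g f is g after f *)

definition Hom :: "('o, 'm) precat \<Rightarrow> 'o \<Rightarrow> 'o \<Rightarrow> 'm set" where
  "Hom B a b = {f \<in> Arr B. Dom B f = a \<and> Cod B f = b}"

locale category =
  fixes B :: "('o, 'm) precat"
  assumes Dom_Obj: "f \<in> Arr B \<Longrightarrow> Dom B f \<in> Obj B"
    and Cod_Obj: "f \<in> Arr B \<Longrightarrow> Cod B f \<in> Obj B"
    and Id_Hom: "a \<in> Obj B \<Longrightarrow> Id B a \<in> Hom B a a"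
    and Comp_Hom: "\<lbrakk>f \<in> Hom B a b; g \<in> Hom B b c\<rbrakk> \<Longrightarrow> Comp B g f \<in> Hom B a c"
    and Comp_Id: "f \<in> Hom B a b \<Longrightarrow> Comp B f (Id B a) = f"
    and Id_Comp: "f \<in> Hom B a b \<Longrightarrow> Comp B (Id B b) f = f"
    and Comp_assoc: "\<lbrakk>f \<in> Hom B a b; g \<in> Hom B b c; h \<in> Hom B c d\<rbrakk>
      \<Longrightarrow> Comp B h (Comp B g f) = Comp B (Comp B h g) f"

record ('e, 'o, 'm) preconcrete =
  CObj :: "'e set"
  Und :: "'e \<Rightarrow> 'o"
  CHom :: "'e \<Rightarrow> 'e \<Rightarrow> 'm set"

locale concrete_category = category B
  for B :: "('o, 'm) precat" +
  fixes E :: "('e, 'o, 'm) preconcrete"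
  assumes Und_Obj: "X \<in> CObj E \<Longrightarrow> Und E X \<in> Obj B"
    and CHom_subset: "\<lbrakk>X \<in> CObj E; Y \<in> CObj E\<rbrakk>
      \<Longrightarrow> CHom E X Y \<subseteq> Hom B (Und E X) (Und E Y)"
    and Id_CHom: "X \<in> CObj E \<Longrightarrow> Id B (Und E X) \<in> CHom E X X"
    and Comp_CHom: "\<lbrakk>X \<in> CObj E; Y \<in> CObj E; Z \<in> CObj E; f \<in> CHom E X Y; g \<in> CHom E Y Z\<rbrakk>
      \<Longrightarrow> Comp B g f \<in> CHom E X Z"

definition concrete_functor ::
    "('d, 'o, 'm) preconcrete \<Rightarrow> ('e, 'o, 'm) preconcrete \<Rightarrow> ('d \<Rightarrow> 'e) \<Rightarrow> bool" where
  "concrete_functor D E F \<longleftrightarrow>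
    (\<forall>X \<in> CObj D. F X \<in> CObj E \<and> Und E (F X) = Und D X) \<and>
    (\<forall>X \<in> CObj D. \<forall>Y \<in> CObj D. CHom D X Y \<subseteq> CHom E (F X) (F Y))"

definition obj_le :: "('o, 'm) precat \<Rightarrow> ('e, 'o, 'm) preconcrete \<Rightarrow> 'e \<Rightarrow> 'e \<Rightarrow> bool" where
  "obj_le B E X Y \<longleftrightarrow> Und E X = Und E Y \<and> Id B (Und E X) \<in> CHom E X Y"

definition obj_cong :: "('o, 'm) precat \<Rightarrow> ('e, 'o, 'm) preconcrete \<Rightarrow> 'e \<Rightarrow> 'e \<Rightarrow> bool" where
  "obj_cong B E X Y \<longleftrightarrow> obj_le B E X Y \<and> obj_le B E Y X"

definition functor_le ::
    "('o, 'm) precat \<Rightarrow> ('d, 'o, 'm) preconcrete \<Rightarrow> ('e, 'o, 'm) preconcrete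
      \<Rightarrow> ('d \<Rightarrow> 'e) \<Rightarrow> ('d \<Rightarrow> 'e) \<Rightarrow> bool" where
  "functor_le B D E F G \<longleftrightarrow> (\<forall>X \<in> CObj D. obj_le B E (F X) (G X))"

definition functor_cong ::
    "('o, 'm) precat \<Rightarrow> ('d, 'o, 'm) preconcrete \<Rightarrow> ('e, 'o, 'm) preconcrete
      \<Rightarrow> ('d \<Rightarrow> 'e) \<Rightarrow> ('d \<Rightarrow> 'e) \<Rightarrow> bool" where
  "functor_cong B D E F G \<longleftrightarrow> (\<forall>X \<in> CObj D. obj_cong B E (F X) (G X))"

definition galois_correspondence ::
    "('o, 'm) precat \<Rightarrow> ('d, 'o, 'm) preconcrete \<Rightarrow> ('e, 'o, 'm) preconcrete
      \<Rightarrow> ('d \<Rightarrow> 'e) \<Rightarrow> ('e \<Rightarrow> 'd) \<Rightarrow> bool" where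
  "galois_correspondence B D E L R \<longleftrightarrow>
    concrete_functor D E L \<and> concrete_functor E D R \<and>
    functor_le B D D (\<lambda>X. X) (R \<circ> L) \<and> functor_le B E E (L \<circ> R) (\<lambda>Y. Y)"

definition initial_source ::
    "('o, 'm) precat \<Rightarrow> ('e, 'o, 'm) preconcrete
      \<Rightarrow> 'i set \<Rightarrow> 'e \<Rightarrow> ('i \<Rightarrow> 'e) \<Rightarrow> ('i \<Rightarrow> 'm) \<Rightarrow> bool" where
  "initial_source B E I Y X g \<longleftrightarrow>
    Y \<in> CObj E \<and> (\<forall>i \<in> I. X i \<in> CObj E \<and> g i \<in> CHom E Y (X i)) \<and>
    (\<forall>Z \<in> CObj E. \<forall>f \<in> Hom B (Und E Z) (Und E Y).
      (\<forall>i \<in> I. Comp B (g i) f \<in> CHom E Z (X i)) \<longrightarrow> f \<in> CHom E Z Y)"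

definition final_sink ::
    "('o, 'm) precat \<Rightarrow> ('e, 'o, 'm) preconcrete
      \<Rightarrow> 'i set \<Rightarrow> ('i \<Rightarrow> 'e) \<Rightarrow> 'e \<Rightarrow> ('i \<Rightarrow> 'm) \<Rightarrow> bool" where
  "final_sink B E I X Y f \<longleftrightarrow>
    Y \<in> CObj E \<and> (\<forall>i \<in> I. X i \<in> CObj E \<and> f i \<in> CHom E (X i) Y) \<and>
    (\<forall>Z \<in> CObj E. \<forall>g \<in> Hom B (Und E Y) (Und E Z).
      (\<forall>i \<in> I. Comp B g (f i) \<in> CHom E (X i) Z) \<longrightarrow> g \<in> CHom E Y Z)"

(* An existential quantifier cannot range over all index types, so the index set is taken inside
   'd * 'm. This is no restriction: a family (X_i, g_i) may be reindexed by the set of its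
   values; see initially_dense_any_index and finally_dense_any_index. *)
definition initially_dense ::
    "('o, 'm) precat \<Rightarrow> ('d, 'o, 'm) preconcrete \<Rightarrow> ('e, 'o, 'm) preconcrete
      \<Rightarrow> ('d \<Rightarrow> 'e) \<Rightarrow> bool" where
  "initially_dense B D E F \<longleftrightarrow>
    (\<forall>Y \<in> CObj E. \<exists>(I :: ('d \<times> 'm) set) X g.
      (\<forall>i \<in> I. X i \<in> CObj D) \<and> initial_source B E I Y (F \<circ> X) g)"

definition finally_dense ::
    "('o, 'm) precat \<Rightarrow> ('d, 'o, 'm) preconcrete \<Rightarrow> ('e, 'o, 'm) preconcrete
      \<Rightarrow> ('d \<Rightarrow> 'e) \<Rightarrow> bool" where
  "finally_dense B D E F \<longleftrightarrow>
    (\<forall>Y \<in> CObj E. \<exists>(I :: ('d \<times> 'm) set) X f.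
      (\<forall>i \<in> I. X i \<in> CObj D) \<and> final_sink B E I (F \<circ> X) Y f)"

lemma initially_dense_any_index:
  fixes B :: "('o, 'm) precat" and D :: "('d, 'o, 'm) preconcrete"
  assumes "\<And>Y. Y \<in> CObj E \<Longrightarrow> \<exists>(I :: 'i set) X g.
      (\<forall>i \<in> I. X i \<in> CObj D) \<and> initial_source B E I Y (F \<circ> X) g"
  shows "initially_dense B D E F"
  unfolding initially_dense_def
proof
  fix Y assume "Y \<in> CObj E"
  then obtain I :: "'i set" and X g where *: "\<forall>i \<in> I. X i \<in> CObj D"
    "initial_source B E I Y (F \<circ> X) g" using assms by blast
  have "initial_source B E ((\<lambda>i. (X i, g i)) ` I) Y (F \<circ> fst) snd"
    using *(2) unfolding initial_source_def by simp
  with *(1) show "\<exists>(I :: ('d \<times> 'm) set) X g. (\<forall>i \<in> I. X i \<in> CObj D) \<and> initial_source B E I Y (F \<circ> X) g"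
    by (intro exI[of _ "(\<lambda>i. (X i, g i)) ` I"] exI[of _ fst] exI[of _ snd]) simp
qed

lemma finally_dense_any_index:
  fixes B :: "('o, 'm) precat" and D :: "('d, 'o, 'm) preconcrete"
  assumes "\<And>Y. Y \<in> CObj E \<Longrightarrow> \<exists>(I :: 'i set) X f.
      (\<forall>i \<in> I. X i \<in> CObj D) \<and> final_sink B E I (F \<circ> X) Y f"
  shows "finally_dense B D E F"
  unfolding finally_dense_def
proof
  fix Y assume "Y \<in> CObj E"
  then obtain I :: "'i set" and X f where *: "\<forall>i \<in> I. X i \<in> CObj D"
    "final_sink B E I (F \<circ> X) Y f" using assms by blast
  have "final_sink B E ((\<lambda>i. (X i, f i)) ` I) (F \<circ> fst) Y snd"
    using *(2) unfolding final_sink_def by simp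
  with *(1) show "\<exists>(I :: ('d \<times> 'm) set) X f. (\<forall>i \<in> I. X i \<in> CObj D) \<and> final_sink B E I (F \<circ> X) Y f"
    by (intro exI[of _ "(\<lambda>i. (X i, f i)) ` I"] exI[of _ fst] exI[of _ snd]) simp
qed

definition full_subcategory ::
    "('e, 'o, 'm) preconcrete \<Rightarrow> 'e set \<Rightarrow> ('e, 'o, 'm) preconcrete" where
  "full_subcategory E S = \<lparr>CObj = S, Und = Und E, CHom = CHom E\<rparr>"

lemma (in concrete_category) concrete_category_full_subcategory:
  assumes "S \<subseteq> CObj E"
  shows "concrete_category B (full_subcategory E S)"
proof unfold_locales
  fix X Y Z f g
  assume "X \<in> CObj (full_subcategory E S)" "Y \<in> CObj (full_subcategory E S)"
    "Z \<in> CObj (full_subcategory E S)" "f \<in> CHom (full_subcategory E S) X Y"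
    "g \<in> CHom (full_subcategory E S) Y Z"
  with assms show "Comp B g f \<in> CHom (full_subcategory E S) X Z"
    using Comp_CHom[of X Y Z f g] by (auto simp: full_subcategory_def)
qed (use assms CHom_subset in \<open>auto simp: full_subcategory_def Und_Obj Id_CHom subset_iff\<close>)

lemma concrete_functor_inclusion:
  "S \<subseteq> CObj E \<Longrightarrow> concrete_functor (full_subcategory E S) E (\<lambda>X. X)"
  by (auto simp: concrete_functor_def full_subcategory_def)

definition sierpinski :: "('o, 'm) precat \<Rightarrow> ('e, 'o, 'm) preconcrete \<Rightarrow> 'e \<Rightarrow> bool" where
  "sierpinski B E X \<longleftrightarrow>
    X \<in> CObj E \<and> initially_dense B (full_subcategory E {X}) E (\<lambda>X. X)"

definition co_sierpinski :: "('o, 'm) precat \<Rightarrow> ('e, 'o, 'm) preconcrete \<Rightarrow> 'e \<Rightarrow> bool" where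
  "co_sierpinski B E X \<longleftrightarrow>
    X \<in> CObj E \<and> finally_dense B (full_subcategory E {X}) E (\<lambda>X. X)"

end

theory Submission imports Defs begin

text \<open>
  The adjunction identity \<open>E(L X, Y) = D(X, R Y)\<close> turns a comparison of two left adjoints into
  a statement about maps out of an object of \<open>D\<close>, and those can be tested along a final sink.
  The inequality \<open>L Y \<le> L' Y\<close> says that the identity is a morphism \<open>L Y \<rightarrow> L' Y\<close>, that
  is, a morphism \<open>Y \<rightarrow> R (L' Y)\<close>. If the maps \<open>f\<^sub>i : F X\<^sub>i \<rightarrow> Y\<close> form a final sink, it
  suffices that every \<open>f\<^sub>i\<close> is a morphism \<open>F X\<^sub>i \<rightarrow> R (L' Y)\<close>, that is, a morphism
  \<open>L (F X\<^sub>i) \<rightarrow> L' Y\<close>. This holds because \<open>L (F X\<^sub>i) \<le> L' (F X\<^sub>i)\<close> and \<open>L'\<close> sends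
  \<open>f\<^sub>i\<close> to a morphism \<open>L' (F X\<^sub>i) \<rightarrow> L' Y\<close>. Exchanging the roles of \<open>L\<close> and \<open>L'\<close> gives
  the other inequality.

  For right adjoints the argument is dual, with initial sources. The adjunction needed for
  \<open>R \<le> R'\<close> is then the one of the larger functor, \<open>(L', R')\<close>. The statements on
  (co-)Sierpinski objects are the case of the inclusion of a one-object full subcategory.
\<close>

context concrete_category
begin

lemma CHom_precompose_le:
  assumes "obj_le B E X Y" "g \<in> CHom E Y Z" "X \<in> CObj E" "Y \<in> CObj E" "Z \<in> CObj E"
  shows "g \<in> CHom E X Z"
proof -
  have "Id B (Und E Y) \<in> CHom E X Y" using assms(1) by (auto simp: obj_le_def)
  then have "Comp B g (Id B (Und E Y)) \<in> CHom E X Z" using assms by (intro Comp_CHom)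
  moreover have "g \<in> Hom B (Und E Y) (Und E Z)" using assms CHom_subset by blast
  ultimately show ?thesis by (simp add: Comp_Id)
qed

lemma CHom_postcompose_le:
  assumes "g \<in> CHom E X Y" "obj_le B E Y Z" "X \<in> CObj E" "Y \<in> CObj E" "Z \<in> CObj E"
  shows "g \<in> CHom E X Z"
proof -
  have "Id B (Und E Y) \<in> CHom E Y Z" using assms(2) by (auto simp: obj_le_def)
  then have "Comp B (Id B (Und E Y)) g \<in> CHom E X Z" using assms by (intro Comp_CHom)
  moreover have "g \<in> Hom B (Und E X) (Und E Y)" using assms CHom_subset by blast
  ultimately show ?thesis by (simp add: Id_Comp)
qed

end

lemma concrete_functor_CObj:
  "\<lbrakk>concrete_functor D E F; X \<in> CObj D\<rbrakk> \<Longrightarrow> F X \<in> CObj E"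
  by (simp add: concrete_functor_def)

lemma concrete_functor_Und:
  "\<lbrakk>concrete_functor D E F; X \<in> CObj D\<rbrakk> \<Longrightarrow> Und E (F X) = Und D X"
  by (simp add: concrete_functor_def)

lemma concrete_functor_CHom:
  "\<lbrakk>concrete_functor D E F; X \<in> CObj D; Y \<in> CObj D; f \<in> CHom D X Y\<rbrakk>
    \<Longrightarrow> f \<in> CHom E (F X) (F Y)"
  by (auto simp: concrete_functor_def)

text \<open>
  A map \<open>L X \<rightarrow> Y\<close> is sent by \<open>R\<close> to \<open>R (L X) \<rightarrow> R Y\<close> and restricted along the unit
  \<open>X \<le> R (L X)\<close>; a map \<open>X \<rightarrow> R Y\<close> is sent by \<open>L\<close> to \<open>L X \<rightarrow> L (R Y)\<close> and extended
  along the counit \<open>L (R Y) \<le> Y\<close>.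
\<close>

lemma galois_correspondence_CHom_eq:
  assumes "concrete_category B D" "concrete_category B E"
    and gal: "galois_correspondence B D E L R"
    and X: "X \<in> CObj D" and Y: "Y \<in> CObj E"
  shows "CHom E (L X) Y = CHom D X (R Y)"
proof -
  interpret D: concrete_category B D by fact
  interpret E: concrete_category B E by fact
  have L: "concrete_functor D E L" and R: "concrete_functor E D R"
    and unit: "obj_le B D X (R (L X))" and counit: "obj_le B E (L (R Y)) Y"
    using gal X Y by (auto simp: galois_correspondence_def functor_le_def)
  have LX: "L X \<in> CObj E" and RY: "R Y \<in> CObj D"
    using L R X Y by (auto intro: concrete_functor_CObj)
  have RLX: "R (L X) \<in> CObj D" and LRY: "L (R Y) \<in> CObj E"
    using L R LX RY by (auto intro: concrete_functor_CObj)
  show ?thesis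
  proof (intro equalityI subsetI)
    fix h assume "h \<in> CHom E (L X) Y"
    then have "h \<in> CHom D (R (L X)) (R Y)" by (rule concrete_functor_CHom[OF R LX Y])
    then show "h \<in> CHom D X (R Y)" by (rule D.CHom_precompose_le[OF unit _ X RLX RY])
  next
    fix h assume "h \<in> CHom D X (R Y)"
    then have "h \<in> CHom E (L X) (L (R Y))" by (rule concrete_functor_CHom[OF L X RY])
    then show "h \<in> CHom E (L X) Y" by (rule E.CHom_postcompose_le[OF _ counit LX LRY Y])
  qed
qed

text \<open>
  Finality of the sink is applied in \<open>D\<close> with target \<open>R (G Y)\<close>: the adjunction is that of the
  smaller functor \<open>L\<close>, while the larger functor \<open>G\<close> transports the maps of the sink.
\<close>

lemma left_adjoint_le_if_le_on_finally_dense: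
  fixes B :: "('o, 'm) precat" and C :: "('c, 'o, 'm) preconcrete"
  assumes "concrete_category B D" "concrete_category B E"
    and dense: "finally_dense B C D F"
    and gal: "galois_correspondence B D E L R" and G: "concrete_functor D E G"
    and le: "functor_le B C E (L \<circ> F) (G \<circ> F)"
  shows "functor_le B D E L G"
  unfolding functor_le_def
proof
  fix Y assume Y: "Y \<in> CObj D"
  interpret D: concrete_category B D by fact
  interpret E: concrete_category B E by fact
  have L: "concrete_functor D E L" and R: "concrete_functor E D R"
    using gal by (auto simp: galois_correspondence_def)
  have GY: "G Y \<in> CObj E" by (rule concrete_functor_CObj[OF G Y])
  have RGY: "R (G Y) \<in> CObj D" by (rule concrete_functor_CObj[OF R GY])
  have Und_RGY: "Und D (R (G Y)) = Und D Y"
    by (simp add: concrete_functor_Und[OF R GY] concrete_functor_Und[OF G Y])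
  obtain I :: "('c \<times> 'm) set" and X f
    where X: "\<forall>i \<in> I. X i \<in> CObj C" and sink: "final_sink B D I (F \<circ> X) Y f"
    using dense Y unfolding finally_dense_def by blast
  have "Comp B (Id B (Und D Y)) (f i) \<in> CHom D (F (X i)) (R (G Y))" if i: "i \<in> I" for i
  proof -
    have FX: "F (X i) \<in> CObj D" and f: "f i \<in> CHom D (F (X i)) Y"
      using sink i by (auto simp: final_sink_def)
    have "obj_le B E (L (F (X i))) (G (F (X i)))"
      using le X i by (simp add: functor_le_def)
    moreover have "f i \<in> CHom E (G (F (X i))) (G Y)"
      by (rule concrete_functor_CHom[OF G FX Y f])
    ultimately have "f i \<in> CHom E (L (F (X i))) (G Y)"
      using concrete_functor_CObj[OF L FX] concrete_functor_CObj[OF G FX] GY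
      by (rule E.CHom_precompose_le)
    then have "f i \<in> CHom D (F (X i)) (R (G Y))"
      using galois_correspondence_CHom_eq[OF assms(1,2) gal FX GY] by simp
    moreover have "f i \<in> Hom B (Und D (F (X i))) (Und D Y)"
      using f D.CHom_subset[OF FX Y] by blast
    ultimately show ?thesis by (simp add: D.Id_Comp)
  qed
  moreover have "Id B (Und D Y) \<in> Hom B (Und D Y) (Und D (R (G Y)))"
    using Und_RGY by (simp add: D.Id_Hom D.Und_Obj[OF Y])
  ultimately have "Id B (Und D Y) \<in> CHom D Y (R (G Y))"
    using sink RGY by (simp add: final_sink_def)
  then have "Id B (Und D Y) \<in> CHom E (L Y) (G Y)"
    using galois_correspondence_CHom_eq[OF assms(1,2) gal Y GY] by simp
  then show "obj_le B E (L Y) (G Y)"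
    by (simp add: obj_le_def concrete_functor_Und[OF L Y] concrete_functor_Und[OF G Y])
qed

text \<open>
  Initiality of the source is applied in \<open>D\<close> to maps out of \<open>L (G Y)\<close>: here the adjunction is
  that of the larger functor \<open>R\<close>, and the smaller functor \<open>G\<close> transports the maps of the source.
\<close>

lemma le_right_adjoint_if_le_on_initially_dense:
  fixes B :: "('o, 'm) precat" and C :: "('c, 'o, 'm) preconcrete"
  assumes "concrete_category B D" "concrete_category B E"
    and dense: "initially_dense B C D F"
    and gal: "galois_correspondence B E D L R" and G: "concrete_functor D E G"
    and le: "functor_le B C E (G \<circ> F) (R \<circ> F)"
  shows "functor_le B D E G R"
  unfolding functor_le_def
proof
  fix Y assume Y: "Y \<in> CObj D"
  interpret D: concrete_category B D by fact
  interpret E: concrete_category B E by fact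
  have L: "concrete_functor E D L" and R: "concrete_functor D E R"
    using gal by (auto simp: galois_correspondence_def)
  have GY: "G Y \<in> CObj E" by (rule concrete_functor_CObj[OF G Y])
  have LGY: "L (G Y) \<in> CObj D" by (rule concrete_functor_CObj[OF L GY])
  have Und_LGY: "Und D (L (G Y)) = Und D Y"
    by (simp add: concrete_functor_Und[OF L GY] concrete_functor_Und[OF G Y])
  obtain I :: "('c \<times> 'm) set" and X g
    where X: "\<forall>i \<in> I. X i \<in> CObj C" and source: "initial_source B D I Y (F \<circ> X) g"
    using dense Y unfolding initially_dense_def by blast
  have "Comp B (g i) (Id B (Und D Y)) \<in> CHom D (L (G Y)) (F (X i))" if i: "i \<in> I" for i
  proof -
    have FX: "F (X i) \<in> CObj D" and g: "g i \<in> CHom D Y (F (X i))"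
      using source i by (auto simp: initial_source_def)
    have "g i \<in> CHom E (G Y) (G (F (X i)))"
      by (rule concrete_functor_CHom[OF G Y FX g])
    moreover have "obj_le B E (G (F (X i))) (R (F (X i)))"
      using le X i by (simp add: functor_le_def)
    ultimately have "g i \<in> CHom E (G Y) (R (F (X i)))"
      using GY concrete_functor_CObj[OF G FX] concrete_functor_CObj[OF R FX]
      by (rule E.CHom_postcompose_le)
    then have "g i \<in> CHom D (L (G Y)) (F (X i))"
      using galois_correspondence_CHom_eq[OF assms(2,1) gal GY FX] by simp
    moreover have "g i \<in> Hom B (Und D Y) (Und D (F (X i)))"
      using g D.CHom_subset[OF Y FX] by blast
    ultimately show ?thesis by (simp add: D.Comp_Id)
  qed
  moreover have "Id B (Und D Y) \<in> Hom B (Und D (L (G Y))) (Und D Y)"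
    using Und_LGY by (simp add: D.Id_Hom D.Und_Obj[OF Y])
  ultimately have "Id B (Und D Y) \<in> CHom D (L (G Y)) Y"
    using source LGY by (simp add: initial_source_def)
  then have "Id B (Und D Y) \<in> CHom E (G Y) (R Y)"
    using galois_correspondence_CHom_eq[OF assms(2,1) gal GY Y] by simp
  then show "obj_le B E (G Y) (R Y)"
    by (simp add: obj_le_def concrete_functor_Und[OF R Y] concrete_functor_Und[OF G Y])
qed

lemma functor_cong_iff_le:
  "functor_cong B D E F G \<longleftrightarrow> functor_le B D E F G \<and> functor_le B D E G F"
  by (auto simp: functor_cong_def functor_le_def obj_cong_def)

lemma left_adjoints_cong_if_cong_on_finally_dense:
  assumes "concrete_category B D" "concrete_category B E" "finally_dense B C D F"
    and "galois_correspondence B D E L R" "galois_correspondence B D E L' R'"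
    and "functor_cong B C E (L \<circ> F) (L' \<circ> F)"
  shows "functor_cong B D E L L'"
proof -
  have "concrete_functor D E L" "concrete_functor D E L'"
    using assms(4,5) by (auto simp: galois_correspondence_def)
  then show ?thesis
    using assms left_adjoint_le_if_le_on_finally_dense[OF assms(1-3)]
    unfolding functor_cong_iff_le by blast
qed

lemma right_adjoints_cong_if_cong_on_initially_dense:
  assumes "concrete_category B D" "concrete_category B E" "initially_dense B C D F"
    and "galois_correspondence B E D L R" "galois_correspondence B E D L' R'"
    and "functor_cong B C E (R \<circ> F) (R' \<circ> F)"
  shows "functor_cong B D E R R'"
proof -
  have "concrete_functor D E R" "concrete_functor D E R'"
    using assms(4,5) by (auto simp: galois_correspondence_def)
  then show ?thesis
    using assms le_right_adjoint_if_le_on_initially_dense[OF assms(1-3)]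
    unfolding functor_cong_iff_le by blast
qed

lemma functor_cong_singleton_iff:
  "functor_cong B (full_subcategory D {X}) E (F \<circ> (\<lambda>X. X)) (G \<circ> (\<lambda>X. X))
    \<longleftrightarrow> obj_cong B E (F X) (G X)"
  by (simp add: functor_cong_def full_subcategory_def)

theorem corollary6p2:
  fixes B :: "('o, 'm) precat"
    and C :: "('c, 'o, 'm) preconcrete"
    and D :: "('d, 'o, 'm) preconcrete"
    and E :: "('e, 'o, 'm) preconcrete"
  assumes "category B"
    and "concrete_category B C" and "concrete_category B D" and "concrete_category B E"
  shows
    "(\<forall>F L R L' R'.
        concrete_functor C D F \<longrightarrow> finally_dense B C D F \<longrightarrow>
        galois_correspondence B D E L R \<longrightarrow> galois_correspondence B D E L' R' \<longrightarrow>
        functor_cong B C E (L \<circ> F) (L' \<circ> F) \<longrightarrow> functor_cong B D E L L') \<and>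
     (\<forall>X L R L' R'.
        co_sierpinski B D X \<longrightarrow>
        galois_correspondence B D E L R \<longrightarrow> galois_correspondence B D E L' R' \<longrightarrow>
        obj_cong B E (L X) (L' X) \<longrightarrow> functor_cong B D E L L') \<and>
     (\<forall>F L R L' R'.
        concrete_functor C D F \<longrightarrow> initially_dense B C D F \<longrightarrow>
        galois_correspondence B E D L R \<longrightarrow> galois_correspondence B E D L' R' \<longrightarrow>
        functor_cong B C E (R \<circ> F) (R' \<circ> F) \<longrightarrow> functor_cong B D E R R') \<and>
     (\<forall>X L R L' R'.
        sierpinski B D X \<longrightarrow>
        galois_correspondence B E D L R \<longrightarrow> galois_correspondence B E D L' R' \<longrightarrow>
        obj_cong B E (R X) (R' X) \<longrightarrow> functor_cong B D E R R')"
proof (intro conjI allI impI)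
  fix F L R L' R'
  assume "finally_dense B C D F" "galois_correspondence B D E L R"
    "galois_correspondence B D E L' R'" "functor_cong B C E (L \<circ> F) (L' \<circ> F)"
  then show "functor_cong B D E L L'"
    by (rule left_adjoints_cong_if_cong_on_finally_dense[OF assms(3,4)])
next
  fix X L R L' R'
  assume "co_sierpinski B D X" and gal: "galois_correspondence B D E L R"
    "galois_correspondence B D E L' R'" and "obj_cong B E (L X) (L' X)"
  then have "finally_dense B (full_subcategory D {X}) D (\<lambda>X. X)"
    "functor_cong B (full_subcategory D {X}) E (L \<circ> (\<lambda>X. X)) (L' \<circ> (\<lambda>X. X))"
    by (simp_all only: co_sierpinski_def functor_cong_singleton_iff)
  then show "functor_cong B D E L L'"
    by (rule left_adjoints_cong_if_cong_on_finally_dense[OF assms(3,4) _ gal])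
next
  fix F L R L' R'
  assume "initially_dense B C D F" "galois_correspondence B E D L R"
    "galois_correspondence B E D L' R'" "functor_cong B C E (R \<circ> F) (R' \<circ> F)"
  then show "functor_cong B D E R R'"
    by (rule right_adjoints_cong_if_cong_on_initially_dense[OF assms(3,4)])
next
  fix X L R L' R'
  assume "sierpinski B D X" and gal: "galois_correspondence B E D L R"
    "galois_correspondence B E D L' R'" and "obj_cong B E (R X) (R' X)"
  then have "initially_dense B (full_subcategory D {X}) D (\<lambda>X. X)"
    "functor_cong B (full_subcategory D {X}) E (R \<circ> (\<lambda>X. X)) (R' \<circ> (\<lambda>X. X))"
    by (simp_all only: sierpinski_def functor_cong_singleton_iff)
  then show "functor_cong B D E R R'"
    by (rule right_adjoints_cong_if_cong_on_initially_dense[OF assms(3,4) _ gal])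
qed

end
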